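(* Let $D_0$ be the set of all Dyck numbers that are neither of the form $2^n-1$ with $n\ge 0$ nor of the form $3\cdot 2^n-1$ with $n\ge 1$. For each asymmetric Dyck number $r$ let $T_r=\{r,\mathcal{B}(r),\mathcal{B}(\mathcal{B}(r)),\dots\}$ be the set of all iterates of $r$ under $\mathcal{B}$ (including $r$ itself). Then there are infinitely many asymmetric Dyck numbers, and $D_0$ is the disjoint union of the sets $T_r$, where $r$ ranges over all asymmetric Dyck numbers. Each $T_r$ is an infinite unary tree with root $r$ (the iterates $r,\mathcal{B}(r),\mathcal{B}(\mathcal{B}(r)),\dots$ are pairwise distinct), and every element of $T_r$ other than $r$ is a symmetric Dyck number belonging to $D_0$.
   Context: A nonnegative integer $d$ is a Dyck number if, in its binary expansion (written without leading zeros, the expansion of $0$ being the empty word), every suffix contains at least as many digits 1 as digits 0. A Dyck number $d$ with $w$ ones and $z\le w$ zeros in its binary expansion encodes the Dyck word of length $2w$ obtained by prepending $w-z$ zeros to the binary expansion. A Dyck word $d_1d_2\cdots d_{2w}$ is symmetric if $d_i\ne d_{2w+1-i}$ for all $1\le i\le 2w$. A Dyck number is symmetric if the Dyck word it encodes is symmetric (in particular $0$ is symmetric), and asymmetric otherwise. The map $\mathcal{B}$ from positive Dyck numbers to symmetric Dyck numbers is defined as follows: write the binary expansion of $d$ as $1s$ with $s$ a binary word (possibly empty, possibly beginning with zeros); let $\bar s$ be the word of the same length obtained by reversing $s$ and swapping $0\leftrightarrow 1$ in every position; then $\mathcal{B}(d)$ is the integer whose binary representation (after removing leading zeros) is the concatenation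 $\bar s s$. For example $\mathcal{B}(13)=21$ and $\mathcal{B}(21)=85$. *)

theory Defs
  imports Main "HOL-Library.Sublist" "HOL-Library.Disjoint_Sets"
begin

text \<open>Binary words are lists of booleans, most significant digit first, with
  \<^term>\<open>True\<close> for the digit 1 and \<^term>\<open>False\<close> for the digit 0.\<close>

fun binary :: "nat \<Rightarrow> bool list" where
  "binary n = (if n = 0 then [] else binary (n div 2) @ [odd n])"

declare binary.simps [simp del]

definition word_value :: "bool list \<Rightarrow> nat" where
  "word_value u = horner_sum of_bool 2 (rev u)"

definition dyck_number :: "nat \<Rightarrow> bool" where
  "dyck_number d \<longleftrightarrow>
     (\<forall>u. suffix u (binary d) \<longrightarrow> count_list u False \<le> count_list u True)"

text \<open>The subtraction below is exact when \<open>d\<close> is a Dyck number; the word then has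
  length \<open>2 * w\<close>.\<close>

definition dyck_word :: "nat \<Rightarrow> bool list" where
  "dyck_word d =
     (let w = count_list (binary d) True; z = count_list (binary d) False
      in replicate (w - z) False @ binary d)"

definition symmetric_word :: "bool list \<Rightarrow> bool" where
  "symmetric_word u \<longleftrightarrow> (\<forall>i\<in>{1..length u}. u ! (i - 1) \<noteq> u ! (length u + 1 - i - 1))"

definition symmetric_dyck :: "nat \<Rightarrow> bool" where
  "symmetric_dyck d \<longleftrightarrow> dyck_number d \<and> symmetric_word (dyck_word d)"

definition asymmetric_dyck :: "nat \<Rightarrow> bool" where
  "asymmetric_dyck d \<longleftrightarrow> dyck_number d \<and> \<not> symmetric_word (dyck_word d)"

text \<open>Only meaningful for positive \<open>d\<close>, where \<^term>\<open>tl (binary d)\<close> drops the leading 1.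
  (As a totalisation artefact, the value at 0 is 0.)\<close>

definition B :: "nat \<Rightarrow> nat" where
  "B d = (let s = tl (binary d) in word_value (map Not (rev s) @ s))"

definition D0 :: "nat set" where
  "D0 = {d. dyck_number d \<and> \<not> (\<exists>n. d = 2 ^ n - 1) \<and> \<not> (\<exists>n\<ge>1. d = 3 * 2 ^ n - 1)}"

definition T :: "nat \<Rightarrow> nat set" where
  "T r = {(B ^^ k) r | k. True}"

text \<open>Rooted trees are given by a vertex set and a parent-to-child relation; in-degree
  at most one, a parentless root and reachability from the root exclude cycles.\<close>

definition rooted_tree :: "'a set \<Rightarrow> ('a \<times> 'a) set \<Rightarrow> 'a \<Rightarrow> bool" where
  "rooted_tree V E r \<longleftrightarrow>
     r \<in> V \<and> E \<subseteq> V \<times> V \<and> (\<forall>u. (u, r) \<notin> E) \<and>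
     (\<forall>v\<in>V - {r}. \<exists>!u. (u, v) \<in> E) \<and> (\<forall>v\<in>V. (r, v) \<in> E\<^sup>*)"

definition infinite_unary_tree :: "'a set \<Rightarrow> ('a \<times> 'a) set \<Rightarrow> 'a \<Rightarrow> bool" where
  "infinite_unary_tree V E r \<longleftrightarrow>
     rooted_tree V E r \<and> infinite V \<and> (\<forall>v\<in>V. \<exists>!w. (v, w) \<in> E)"

end

theory Submission
  imports Defs
begin

text \<open>Writing \<open>s'\<close> for the reversed complement of \<open>s\<close>, the word \<open>s' s\<close> is a symmetric
  Dyck word whenever \<open>1 s\<close> is the expansion of a Dyck number, and every symmetric Dyck word is
  \<open>s' s\<close> with \<open>s\<close> its second half. Hence \<open>B\<close> is injective on positive Dyck numbers, with image
  the symmetric ones. If \<open>m\<close> is the value of \<open>s'\<close> and \<open>l\<close> the length of \<open>s\<close>, then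
  \<open>B d - d = (m - 1) 2^l\<close>; the cases \<open>m = 0\<close> and \<open>m = 1\<close> are the two excluded families, so
  \<open>B\<close> strictly increases on \<^term>\<open>D0\<close>, and going back along \<open>B\<close> from a member of \<^term>\<open>D0\<close>
  ends at an asymmetric number.\<close>

section \<open>Values of words and binary expansions\<close>

lemma word_value_Nil [simp]: "word_value [] = 0"
  by (simp add: word_value_def)

lemma word_value_append: "word_value (u @ v) = word_value u * 2 ^ length v + word_value v"
  by (simp add: word_value_def horner_sum_append)

lemma word_value_single [simp]: "word_value [b] = of_bool b"
  by (simp add: word_value_def)

lemma word_value_Cons: "word_value (b # u) = of_bool b * 2 ^ length u + word_value u"
  using word_value_append[of "[b]" u] by simp

lemma word_value_replicate_False [simp]: "word_value (replicate n False) = 0"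
  by (induction n) (simp_all add: word_value_Cons)

lemma word_value_replicate_True: "word_value (replicate n True) = 2 ^ n - 1"
  by (induction n) (simp_all add: word_value_Cons)

lemma word_value_binary [simp]: "word_value (binary d) = d"
proof (induction d rule: binary.induct)
  case (1 d)
  then show ?case
    using div_mult_mod_eq[of d 2]
    by (cases "d = 0") (simp_all add: binary.simps[of d] binary.simps[of 0] word_value_append of_bool_odd_eq_mod_2)
qed

lemma word_value_eq_0D: "word_value u = 0 \<Longrightarrow> u = replicate (length u) False"
  by (induction u) (auto simp: word_value_Cons split: if_splits)

lemma word_value_eq_1D:
  assumes "word_value u = 1"
  shows "\<exists>k. u = replicate k False @ [True]"
proof (cases u rule: rev_cases)
  case Nil
  with assms show ?thesis by simp
next
  case (snoc v b)
  \<comment> \<open>Parity forces the last digit to be 1; the rest then has value 0.\<close>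
  with assms have "b" "word_value v = 0"
    by (cases b; auto simp: word_value_append; presburger)+
  with snoc show ?thesis by (metis word_value_eq_0D)
qed

lemma binary_double_plus:
  "binary (2 * n + of_bool b) = (if n = 0 \<and> \<not> b then [] else binary n @ [b])"
  by (subst binary.simps) auto

lemma binary_word_value: "binary (word_value u) = dropWhile Not u"
proof (induction u rule: rev_induct)
  case Nil
  then show ?case by (simp add: binary.simps)
next
  case (snoc b u)
  have "binary (word_value (u @ [b])) = binary (2 * word_value u + of_bool b)"
    by (simp add: word_value_append mult.commute)
  also have "\<dots> = (if word_value u = 0 \<and> \<not> b then [] else binary (word_value u) @ [b])"
    by (rule binary_double_plus)
  also have "\<dots> = dropWhile Not (u @ [b])"
  proof (cases "word_value u = 0")
    case True
    then obtain k where "u = replicate k False" using word_value_eq_0D by blast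
    then show ?thesis using snoc True by (simp add: dropWhile_append)
  next
    case False
    then have "\<not> (\<forall>x\<in>set u. \<not> x)"
      by (metis (full_types) replicate_eqI word_value_replicate_False)
    then show ?thesis using snoc False by (auto simp: dropWhile_append)
  qed
  finally show ?case .
qed

lemma binary_word_value_True [simp]: "binary (word_value (True # u)) = True # u"
  by (simp add: binary_word_value)

lemma binary_pos:
  assumes "d > 0"
  obtains s where "binary d = True # s" "d = word_value (True # s)"
proof (cases "binary d")
  case Nil
  then show ?thesis using assms word_value_binary[of d] by simp
next
  case (Cons b s)
  \<comment> \<open>Encoding the value of \<open>binary d\<close> again gives
    \<open>binary d\<close> back, so it has no leading zeros.\<close>
  have "dropWhile Not (binary d) = binary d"
    using binary_word_value[of "binary d"] by simp
  with Cons have "\<not> Not b" using dropWhile_eq_self_iff[of Not "binary d"] by simp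
  with Cons have "binary d = True # s" by simp
  moreover from this have "d = word_value (True # s)" using word_value_binary[of d] by simp
  ultimately show ?thesis by (rule that)
qed

section \<open>The reversed complement, written as a bar in the definition of
  \<open>B\<close>\<close>

definition dual :: "bool list \<Rightarrow> bool list" where
  "dual s = map Not (rev s)"

lemma length_dual [simp]: "length (dual s) = length s"
  by (simp add: dual_def)

lemma dual_append: "dual (u @ v) = dual v @ dual u"
  by (simp add: dual_def)

lemma dual_dual [simp]: "dual (dual s) = s"
  by (simp add: dual_def rev_map comp_def)

lemma dual_replicate [simp]: "dual (replicate n b) = replicate n (\<not> b)"
  by (simp add: dual_def)

lemma dual_single [simp]: "dual [b] = [\<not> b]"
  by (simp add: dual_def)

lemma count_list_dual: "count_list (dual s) b = count_list s (\<not> b)"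
  by (induction s) (auto simp: dual_def)

lemma count_list_bool: "count_list u True + count_list u False = length u"
  by (induction u) auto

lemma symmetric_word_iff_dual: "symmetric_word u \<longleftrightarrow> dual u = u"
proof -
  have "symmetric_word u \<longleftrightarrow> (\<forall>i<length u. u ! i \<noteq> u ! (length u - Suc i))"
  proof -
    \<comment> \<open>Shift from positions counted from 1 to list indices counted from 0.\<close>
    have "{1..length u} = Suc ` {..<length u}"
      by (simp add: image_Suc_lessThan)
    then show ?thesis by (simp add: symmetric_word_def) auto
  qed
  also have "\<dots> \<longleftrightarrow> dual u = u"
    by (auto simp: list_eq_iff_nth_eq dual_def rev_nth)
  finally show ?thesis .
qed

section \<open>The Dyck condition for words that may begin with zeros\<close>

definition suffix_dominated :: "bool list \<Rightarrow> bool" where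
  "suffix_dominated u \<longleftrightarrow> (\<forall>v. suffix v u \<longrightarrow> count_list v False \<le> count_list v True)"

lemma dyck_number_iff: "dyck_number d \<longleftrightarrow> suffix_dominated (binary d)"
  by (simp add: dyck_number_def suffix_dominated_def)

lemma suffix_dominated_suffix: "suffix_dominated u \<Longrightarrow> suffix v u \<Longrightarrow> suffix_dominated v"
  unfolding suffix_dominated_def using suffix_order.trans by blast

lemma suffix_dominated_Cons:
  "suffix_dominated (b # u) \<longleftrightarrow>
     suffix_dominated u \<and> count_list (b # u) False \<le> count_list (b # u) True"
  by (auto simp: suffix_dominated_def suffix_Cons)

text \<open>The only new suffix is the whole word, where the extra 1 can only help. Thus the tail of
  a positive Dyck number's expansion carries the Dyck condition by itself.\<close>

lemma suffix_dominated_True_Cons [simp]: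
  "suffix_dominated (True # u) \<longleftrightarrow> suffix_dominated u"
  by (auto simp: suffix_dominated_Cons) (auto simp: suffix_dominated_def le_Suc_eq)

lemma suffix_dominated_replicate_False:
  assumes "suffix_dominated u" "count_list u False + n \<le> count_list u True"
  shows "suffix_dominated (replicate n False @ u)"
  using assms(2)
proof (induction n)
  case 0
  with assms show ?case by simp
next
  case (Suc n)
  have "count_list (replicate n False @ u) True = count_list u True"
    "count_list (replicate n False @ u) False = n + count_list u False"
    by (induction n) auto
  with Suc show ?case by (simp add: suffix_dominated_Cons)
qed

lemma suffix_dominated_replicate_True:
  "suffix_dominated u \<Longrightarrow> suffix_dominated (replicate n True @ u)"
  by (induction n) auto

text \<open>A suffix reaching into \<open>dual s\<close> has the form \<open>dual p @ p @ q\<close> with \<open>s = p @ q\<close>, and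
  \<open>dual p @ p\<close> is balanced.\<close>

lemma suffix_dominated_dual_append:
  assumes "suffix_dominated s"
  shows "suffix_dominated (dual s @ s)"
  unfolding suffix_dominated_def
proof (intro allI impI)
  fix v assume "suffix v (dual s @ s)"
  then consider "suffix v s" | x where "v = x @ s" "suffix x (dual s)"
    by (auto simp: suffix_append)
  then show "count_list v False \<le> count_list v True"
  proof cases
    case 1
    with assms show ?thesis by (simp add: suffix_dominated_def)
  next
    case 2
    then obtain y where "dual s = y @ x" by (auto simp: suffix_def)
    then have s: "s = dual x @ dual y" by (metis dual_append dual_dual)
    have "count_list (dual y) False \<le> count_list (dual y) True"
      using assms s suffixI[of s "dual x" "dual y"] by (simp add: suffix_dominated_def)
    then show ?thesis using 2 s by (simp add: count_list_dual)
  qed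
qed

section \<open>Dyck words and the numbers encoding them\<close>

lemma word_value_dyck_word [simp]: "word_value (dyck_word d) = d"
  by (simp add: dyck_word_def Let_def word_value_append)

lemma suffix_dominated_dyck_word:
  assumes "dyck_number d"
  shows "suffix_dominated (dyck_word d)"
proof -
  have "suffix_dominated (binary d)" using assms by (simp add: dyck_number_iff)
  moreover from this have "count_list (binary d) False \<le> count_list (binary d) True"
    by (simp add: suffix_dominated_def)
  ultimately show ?thesis
    by (simp add: dyck_word_def Let_def suffix_dominated_replicate_False)
qed

lemma count_list_replicate: "count_list (replicate n x) y = (if x = y then n else 0)"
  by (induction n) auto

text \<open>Taking the value loses only the leading zeros. Balance says that their number is the
  excess of ones over zeros in what remains, which is exactly the padding that
  \<open>dyck_word\<close> restores.\<close>

lemma dyck_word_of_balanced: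
  assumes "suffix_dominated u" "count_list u True = count_list u False"
  shows "dyck_number (word_value u)" "dyck_word (word_value u) = u"
proof -
  let ?b = "binary (word_value u)"
  define k where "k = length (takeWhile Not u)"
  have "takeWhile Not u = replicate k False"
    unfolding k_def by (rule replicate_eqI) (auto dest: set_takeWhileD)
  then have u: "u = replicate k False @ ?b"
    by (metis binary_word_value takeWhile_dropWhile_id)
  then have "suffix ?b u" by (metis suffixI)
  with assms show "dyck_number (word_value u)"
    by (simp add: dyck_number_iff suffix_dominated_suffix)
  have "count_list u True = count_list ?b True" "count_list u False = k + count_list ?b False"
    by (subst u, simp add: count_list_replicate)+
  with assms have "k = count_list ?b True - count_list ?b False" by simp
  with u show "dyck_word (word_value u) = u" by (simp add: dyck_word_def Let_def)
qed

section \<open>The map \<open>B\<close> on words: symmetric image and injectivity\<close>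

lemma B_word_value: "B (word_value (True # s)) = word_value (dual s @ s)"
  by (simp add: B_def dual_def)

text \<open>\<open>dual\<close> swaps the two digit counts, so the word is balanced and is recovered
  from its value. It is symmetric because \<open>dual\<close> reverses concatenation and is an
  involution.\<close>

lemma
  assumes "suffix_dominated s"
  shows symmetric_dyck_dual_append: "symmetric_dyck (word_value (dual s @ s))"
    and dyck_word_dual_append: "dyck_word (word_value (dual s @ s)) = dual s @ s"
proof -
  have "count_list (dual s @ s) True = count_list (dual s @ s) False"
    by (simp add: count_list_dual)
  note * = dyck_word_of_balanced[OF suffix_dominated_dual_append[OF assms] this]
  from * show "dyck_word (word_value (dual s @ s)) = dual s @ s" by simp
  with * show "symmetric_dyck (word_value (dual s @ s))"
    by (simp add: symmetric_dyck_def symmetric_word_iff_dual dual_append)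
qed

lemma dyck_number_pos:
  assumes "dyck_number d" "d > 0"
  obtains s where "suffix_dominated s" "d = word_value (True # s)"
  using assms by (metis binary_pos dyck_number_iff suffix_dominated_True_Cons)

lemma symmetric_dyck_B: "dyck_number d \<Longrightarrow> d > 0 \<Longrightarrow> symmetric_dyck (B d)"
  by (metis dyck_number_pos B_word_value symmetric_dyck_dual_append)

lemma B_inject:
  assumes "dyck_number d" "d > 0" "dyck_number e" "e > 0" "B d = B e"
  shows "d = e"
proof -
  obtain s where s: "suffix_dominated s" "d = word_value (True # s)"
    using assms(1,2) by (rule dyck_number_pos)
  obtain t where t: "suffix_dominated t" "e = word_value (True # t)"
    using assms(3,4) by (rule dyck_number_pos)
  \<comment> \<open>Equal values alone could hide different numbers of leading zeros; passing to the
    Dyck words restores them.\<close>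
  have "dual s @ s = dual t @ t"
    using s t assms(5) by (metis B_word_value dyck_word_dual_append)
  moreover from this have "length s = length t"
    by (metis length_append length_dual add_self_div_2 mult_2)
  ultimately show ?thesis using s t by simp
qed

lemma symmetric_dyck_preimage:
  assumes "symmetric_dyck d"
  obtains e where "dyck_number e" "e > 0" "B e = d"
proof -
  define u where "u = dyck_word d"
  have d: "dyck_number d" and u: "dual u = u"
    using assms by (auto simp: symmetric_dyck_def symmetric_word_iff_dual u_def)
  \<comment> \<open>Since \<open>dual\<close> fixes \<open>u\<close>, zeros are as many as ones. So
    \<open>m\<close> is half the length, and \<open>s\<close> is the second half.\<close>
  define m where "m = count_list u True"
  define s where "s = drop m u"
  have "count_list u False = m" by (metis u count_list_dual m_def)
  then have len: "length u = m + m" using count_list_bool[of u] by (simp add: m_def)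
  have "dual (take m u @ s) = take m u @ s" by (simp add: s_def u)
  then have "dual s @ dual (take m u) = take m u @ s" by (simp add: dual_append)
  moreover have "length (dual s) = length (take m u)" using len by (simp add: s_def)
  ultimately have "take m u = dual s" using append_eq_append_conv by metis
  then have us: "u = dual s @ s" by (metis append_take_drop_id s_def)
  have "suffix_dominated s"
    using suffix_dominated_dyck_word[OF d] us
    by (metis suffixI suffix_dominated_suffix u_def)
  \<comment> \<open>The preimage is the second half with a 1 in front; for d = 0 the half is empty
    and the preimage is 1.\<close>
  then have "dyck_number (word_value (True # s))" by (simp add: dyck_number_iff)
  moreover have "word_value (True # s) > 0" by (simp add: word_value_Cons)
  moreover have "B (word_value (True # s)) = d"
    by (metis B_word_value us u_def word_value_dyck_word)
  ultimately show ?thesis by (rule that)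
qed

section \<open>The two excluded families\<close>

lemma word_value_True_False_replicate_True:
  "word_value (True # False # replicate n True) = 3 * 2 ^ n - 1"
  by (simp add: word_value_Cons word_value_replicate_True)

lemma binary_pow2_minus_1: "binary (2 ^ n - 1) = replicate n True"
proof -
  have "dropWhile Not (replicate n True) = replicate n True" by (cases n) simp_all
  then show ?thesis using binary_word_value[of "replicate n True"]
    by (simp only: word_value_replicate_True)
qed

lemma suffix_dominated_Nil [simp]: "suffix_dominated []"
  by (simp add: suffix_dominated_def)

lemma dyck_number_pow2: "dyck_number (2 ^ n - 1)"
  using suffix_dominated_replicate_True[of "[]" n]
  unfolding dyck_number_iff binary_pow2_minus_1 by simp

lemma dyck_number_3pow2:
  assumes "n \<ge> 1"
  shows "dyck_number (3 * 2 ^ n - 1)"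
proof -
  have "suffix_dominated (replicate 1 False @ replicate n True)"
    using assms suffix_dominated_replicate_True[of "[]" n]
    by (intro suffix_dominated_replicate_False) (auto simp: count_list_replicate)
  then show ?thesis
    unfolding dyck_number_iff word_value_True_False_replicate_True[symmetric] by simp
qed

lemma three_pow2_pos: "(3 * 2 ^ n - 1 :: nat) > 0"
  using one_le_power[of "2::nat" n] by linarith

text \<open>The reversed complement of a block of ones consists of zeros, so \<open>B\<close> just
  removes the leading 1 and moves down this family towards 0.\<close>

lemma B_pow2: "B (2 ^ Suc n - 1) = 2 ^ n - 1"
  using B_word_value[of "replicate n True"] word_value_replicate_True[of "Suc n"]
  by (simp add: word_value_append word_value_replicate_True)

text \<open>Here \<open>dual ?s\<close> is a 1 preceded by zeros, so it has the same value as the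
  leading 1 that it replaces: these are fixed points of \<open>B\<close>.\<close>

lemma B_3pow2: "B (3 * 2 ^ n - 1) = 3 * 2 ^ n - 1"
proof -
  let ?s = "False # replicate n True"
  have "dual ?s = replicate n False @ [True]"
    using dual_append[of "[False]" "replicate n True"] by simp
  then show ?thesis
    using B_word_value[of ?s] word_value_True_False_replicate_True[of n]
    by (simp add: word_value_append word_value_Cons)
qed

section \<open>Growth of \<open>B\<close> and invariance of \<open>D0\<close>\<close>

lemma D0_pos: "d \<in> D0 \<Longrightarrow> d > 0"
  \<comment> \<open>Zero is excluded as 2^0 - 1.\<close>
  unfolding D0_def by (cases "d = 0") (auto dest: spec[of _ "0::nat"])

lemma D0_dyck: "d \<in> D0 \<Longrightarrow> dyck_number d"
  by (simp add: D0_def)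

lemma B_gt:
  assumes "d \<in> D0"
  shows "d < B d"
proof -
  obtain s where s: "suffix_dominated s" "d = word_value (True # s)"
    using dyck_number_pos[OF D0_dyck[OF assms] D0_pos[OF assms]] .
  have Bd: "B d = word_value (dual s) * 2 ^ length s + word_value s"
    unfolding s(2) B_word_value by (rule word_value_append)
  have "word_value (dual s) \<noteq> 0"
  proof
    assume "word_value (dual s) = 0"
    then obtain n where "dual s = replicate n False" by (metis word_value_eq_0D)
    then have "s = replicate n True" by (metis dual_dual dual_replicate)
    then have "d = 2 ^ Suc n - 1"
      using s word_value_replicate_True[of "Suc n"] by simp
    then have "d \<notin> D0" unfolding D0_def by blast
    with assms show False by simp
  qed
  moreover have "word_value (dual s) \<noteq> 1"
  proof
    assume "word_value (dual s) = 1"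
    then obtain n where "dual s = replicate n False @ [True]" by (metis word_value_eq_1D)
    then have "s = dual (replicate n False @ [True])" by (metis dual_dual)
    then have sn: "s = False # replicate n True" by (simp add: dual_append)
    \<comment> \<open>For n = 0 the tail would be a lone zero, violating the suffix
      condition.\<close>
    then have "n \<ge> 1" using s(1) by (cases n) (auto simp: suffix_dominated_Cons)
    moreover have "d = 3 * 2 ^ n - 1"
      using s sn word_value_True_False_replicate_True by simp
    ultimately show False using assms by (auto simp: D0_def)
  qed
  ultimately have "word_value (dual s) \<ge> 2" by linarith
  then have "word_value (dual s) * 2 ^ length s \<ge> 2 * 2 ^ length s" by simp
  moreover have "(2::nat) ^ length s > 0" by simp
  ultimately have "2 ^ length s < word_value (dual s) * 2 ^ length s" by linarith
  then show ?thesis using Bd s(2) by (simp add: word_value_Cons)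
qed

text \<open>\<open>B\<close> sends positive members of either excluded family into the same family.
  Conversely, each member of a family already has a positive Dyck preimage in that family, and
  injectivity allows no other.\<close>

lemma B_in_D0_iff:
  assumes "dyck_number d" "d > 0"
  shows "B d \<in> D0 \<longleftrightarrow> d \<in> D0"
proof
  assume L: "B d \<in> D0"
  have "d \<noteq> 2 ^ n - 1" for n
  proof
    assume "d = 2 ^ n - 1"
    \<comment> \<open>Positivity of d rules out n = 0.\<close>
    with assms obtain m where "d = 2 ^ Suc m - 1" by (cases n) auto
    then have "B d = 2 ^ m - 1" by (simp only: B_pow2)
    then have "B d \<notin> D0" unfolding D0_def by blast
    with L show False by simp
  qed
  moreover have "d \<noteq> 3 * 2 ^ n - 1" if "n \<ge> 1" for n
    using L that B_3pow2[of n] by (auto simp: D0_def)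
  ultimately show "d \<in> D0" using assms by (auto simp: D0_def)
next
  assume R: "d \<in> D0"
  have "B d \<noteq> 2 ^ n - 1" for n
  proof
    assume "B d = 2 ^ n - 1"
    moreover have "(2 ^ Suc n - 1 :: nat) > 0" using one_less_power[of "2::nat" "Suc n"] by simp
    ultimately have "d = 2 ^ Suc n - 1"
      using B_inject[OF assms dyck_number_pow2[of "Suc n"]] B_pow2[of n] by simp
    then have "d \<notin> D0" unfolding D0_def by blast
    with R show False by simp
  qed
  moreover have "B d \<noteq> 3 * 2 ^ n - 1" if "n \<ge> 1" for n
  proof
    assume "B d = 3 * 2 ^ n - 1"
    then have "d = 3 * 2 ^ n - 1"
      using B_inject[OF assms dyck_number_3pow2[OF that] three_pow2_pos] B_3pow2[of n] by simp
    with R that show False by (auto simp: D0_def)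
  qed
  ultimately show "B d \<in> D0"
    using symmetric_dyck_B[OF assms] by (auto simp: D0_def symmetric_dyck_def)
qed

lemma B_in_D0: "d \<in> D0 \<Longrightarrow> B d \<in> D0"
  using B_in_D0_iff D0_dyck D0_pos by blast

lemma symmetric_dyck_B_D0: "d \<in> D0 \<Longrightarrow> symmetric_dyck (B d)"
  using symmetric_dyck_B D0_dyck D0_pos by blast

lemma inj_on_B_D0: "inj_on B D0"
  using B_inject D0_dyck D0_pos by (intro inj_onI) blast

lemma funpow_B_in_D0: "d \<in> D0 \<Longrightarrow> (B ^^ k) d \<in> D0"
  by (induction k) (simp_all add: B_in_D0)

lemma strict_mono_funpow_B: "d \<in> D0 \<Longrightarrow> strict_mono (\<lambda>k. (B ^^ k) d)"
  by (simp add: strict_mono_Suc_iff B_gt funpow_B_in_D0)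

section \<open>Asymmetric Dyck numbers\<close>

lemma asymmetric_dyck_not_symmetric: "asymmetric_dyck r \<Longrightarrow> \<not> symmetric_dyck r"
  by (simp add: asymmetric_dyck_def symmetric_dyck_def)

text \<open>Every member of an excluded family is symmetric, being a value of \<open>B\<close> at a
  positive Dyck number: the next member of the first family, or the number itself in the
  second.\<close>

lemma asymmetric_dyck_in_D0:
  assumes "asymmetric_dyck r"
  shows "r \<in> D0"
proof -
  have "r \<noteq> 2 ^ n - 1" for n :: nat
    using assms symmetric_dyck_B[OF dyck_number_pow2[of "Suc n"]]
      B_pow2[of n] one_less_power[of "2::nat" "Suc n"]
    by (auto dest: asymmetric_dyck_not_symmetric)
  moreover have "r \<noteq> 3 * 2 ^ n - 1" if "n \<ge> 1" for n
    using assms symmetric_dyck_B[OF dyck_number_3pow2[OF that]] B_3pow2[of n]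
    by (metis asymmetric_dyck_not_symmetric three_pow2_pos)
  ultimately show ?thesis using assms by (auto simp: D0_def asymmetric_dyck_def)
qed

lemma infinite_asymmetric_dyck: "infinite {r. asymmetric_dyck r}"
proof -
  \<comment> \<open>The Dyck word of \<open>f n\<close> starts with 00, its reversed complement with
    01. At least two leading ones are needed: a single one would give the symmetric word
    0101.\<close>
  define f where "f n = word_value (replicate (Suc (Suc n)) True @ [False, True])" for n
  have bin: "binary (f n) = replicate (Suc (Suc n)) True @ [False, True]" for n
    by (simp add: f_def)
  have "asymmetric_dyck (f n)" for n
  proof -
    have "suffix_dominated (binary (f n))"
      unfolding bin by (rule suffix_dominated_replicate_True) (simp add: suffix_dominated_Cons)
    moreover have "dyck_word (f n) = False # False # replicate n False
        @ replicate (Suc (Suc n)) True @ [False, True]"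
      unfolding dyck_word_def bin by (simp add: count_list_replicate)
    then have "\<not> symmetric_word (dyck_word (f n))"
      by (simp add: symmetric_word_iff_dual dual_def)
    ultimately show ?thesis by (simp add: asymmetric_dyck_def dyck_number_iff)
  qed
  then have "range f \<subseteq> {r. asymmetric_dyck r}" by auto
  moreover have "inj f"
  proof (rule injI)
    fix m n assume "f m = f n"
    then have "length (binary (f m)) = length (binary (f n))" by simp
    then show "m = n" by (simp add: bin)
  qed
  ultimately show ?thesis
    using finite_imageD infinite_UNIV_nat finite_subset by blast
qed

section \<open>Orbits of asymmetric numbers partition \<open>D0\<close>\<close>

lemma funpow_B_asymmetric_eq:
  assumes "asymmetric_dyck r" "d \<in> D0" "(B ^^ i) r = (B ^^ j) d" "i \<le> j"
  shows "r = d \<and> i = j"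
  using assms(3,4)
\<comment> \<open>Injectivity cancels one \<open>B\<close> on both sides at a time. Once i = 0, a
  positive j would make r a value of \<open>B\<close> on \<open>D0\<close>, hence symmetric.\<close>
proof (induction i arbitrary: j)
  case 0
  then show ?case
    using symmetric_dyck_B_D0[OF funpow_B_in_D0[OF assms(2)]] assms(1)
    by (cases j) (auto dest: asymmetric_dyck_not_symmetric)
next
  case (Suc i)
  then obtain j' where j': "j = Suc j'" by (cases j) auto
  with Suc have "(B ^^ i) r = (B ^^ j') d"
    using assms(1,2) inj_onD[OF inj_on_B_D0]
    by (simp add: asymmetric_dyck_in_D0 funpow_B_in_D0)
  with Suc j' show ?case by simp
qed

lemma disjoint_family_T: "disjoint_family_on T {r. asymmetric_dyck r}"
  unfolding disjoint_family_on_def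
proof (intro ballI impI)
  fix r q assume rq: "r \<in> {r. asymmetric_dyck r}" "q \<in> {r. asymmetric_dyck r}" "r \<noteq> q"
  have False if "(B ^^ i) r = (B ^^ j) q" for i j
    \<comment> \<open>The lemma requires i \<le> j, so the roots swap roles in the other
      case.\<close>
    using that rq funpow_B_asymmetric_eq[of r q i j] funpow_B_asymmetric_eq[of q r j i]
    by (cases i j rule: le_cases) (auto simp: asymmetric_dyck_in_D0)
  then show "T r \<inter> T q = {}" by (auto simp: T_def)
qed

lemma T_subset_D0: "asymmetric_dyck r \<Longrightarrow> T r \<subseteq> D0"
  by (auto simp: T_def asymmetric_dyck_in_D0 funpow_B_in_D0)

lemma root_in_T: "r \<in> T r"
  unfolding T_def by (force intro: exI[of _ "0::nat"])

lemma B_in_T: "d \<in> T r \<Longrightarrow> B d \<in> T r"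
  unfolding T_def by clarsimp (metis funpow.simps(2) comp_apply)

lemma T_not_rootE:
  assumes "d \<in> T r" "d \<noteq> r"
  obtains e where "e \<in> T r" "d = B e"
proof -
  obtain k where "d = (B ^^ k) r" using assms by (auto simp: T_def)
  with assms that show ?thesis by (cases k) (auto simp: T_def)
qed

text \<open>A symmetric member of \<open>D0\<close> has a preimage that again lies in
  \<open>D0\<close> and is smaller by \<open>B_gt\<close>, so descent must end at an asymmetric
  number.\<close>

lemma D0_in_some_T: "d \<in> D0 \<Longrightarrow> \<exists>r. asymmetric_dyck r \<and> d \<in> T r"
proof (induction d rule: less_induct)
  case (less d)
  show ?case
  proof (cases "symmetric_dyck d")
    case True
    then obtain e where e: "dyck_number e" "e > 0" "B e = d"
      by (rule symmetric_dyck_preimage)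
    with less.prems have "e \<in> D0" using B_in_D0_iff by blast
    then show ?thesis using less.IH[of e] B_gt[of e] e B_in_T by blast
  next
    case False
    then have "asymmetric_dyck d"
      using D0_dyck[OF less.prems] by (simp add: symmetric_dyck_def asymmetric_dyck_def)
    then show ?thesis using root_in_T by blast
  qed
qed

lemma infinite_unary_tree_T:
  assumes "asymmetric_dyck r"
  shows "infinite_unary_tree (T r) {(d, B d) | d. d \<in> T r} r"
proof -
  let ?E = "{(d, B d) | d. d \<in> T r}"
  have r: "r \<in> D0" using assms by (rule asymmetric_dyck_in_D0)
  have D0: "T r \<subseteq> D0" using assms by (rule T_subset_D0)
  \<comment> \<open>A parent of r would make r symmetric.\<close>
  have "(u, r) \<notin> ?E" for u
    using assms D0 symmetric_dyck_B_D0 asymmetric_dyck_not_symmetric by blast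
  moreover have "\<exists>!u. (u, v) \<in> ?E" if v: "v \<in> T r - {r}" for v
  proof -
    obtain e where "e \<in> T r" "v = B e" using v T_not_rootE by blast
    then show ?thesis using D0 inj_onD[OF inj_on_B_D0] by blast
  qed
  moreover have "(r, v) \<in> ?E\<^sup>*" if "v \<in> T r" for v
  proof -
    have "(r, (B ^^ k) r) \<in> ?E\<^sup>*" for k
    proof (induction k)
      case (Suc k)
      have "((B ^^ k) r, (B ^^ Suc k) r) \<in> ?E" by (auto simp: T_def)
      with Suc show ?case by (rule rtrancl_into_rtrancl)
    qed simp
    with that show ?thesis by (auto simp: T_def)
  qed
  moreover have "infinite (T r)"
  proof
    assume "finite (T r)"
    \<comment> \<open>The orbit is strictly increasing, so a finite range would make the set of
      exponents finite.\<close>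
    then have "finite (range (\<lambda>k. (B ^^ k) r))" by (simp add: T_def full_SetCompr_eq)
    then have "finite (UNIV :: nat set)"
      by (rule finite_imageD) (intro strict_mono_imp_inj_on strict_mono_funpow_B r)
    then show False by simp
  qed
  moreover have "?E \<subseteq> T r \<times> T r" using B_in_T by blast
  moreover have "\<exists>!w. (v, w) \<in> ?E" if "v \<in> T r" for v using that by blast
  ultimately show ?thesis
    unfolding infinite_unary_tree_def rooted_tree_def
    by (intro conjI ballI allI root_in_T) assumption+
qed

theorem proposition8:
  "infinite {r. asymmetric_dyck r} \<and>
   D0 = (\<Union>r\<in>{r. asymmetric_dyck r}. T r) \<and>
   disjoint_family_on T {r. asymmetric_dyck r} \<and>
   (\<forall>r. asymmetric_dyck r \<longrightarrow>
      infinite_unary_tree (T r) {(d, B d) | d. d \<in> T r} r \<and>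
      inj (\<lambda>k. (B ^^ k) r) \<and>
      (\<forall>d\<in>T r - {r}. symmetric_dyck d \<and> d \<in> D0))"
proof (intro conjI allI impI ballI)
  show "infinite {r. asymmetric_dyck r}" by (rule infinite_asymmetric_dyck)
  show "D0 = (\<Union>r\<in>{r. asymmetric_dyck r}. T r)" using D0_in_some_T T_subset_D0 by blast
  show "disjoint_family_on T {r. asymmetric_dyck r}" by (rule disjoint_family_T)
next
  fix r assume r: "asymmetric_dyck r"
  then show "infinite_unary_tree (T r) {(d, B d) | d. d \<in> T r} r"
    by (rule infinite_unary_tree_T)
  show "inj (\<lambda>k. (B ^^ k) r)"
    by (intro strict_mono_imp_inj_on strict_mono_funpow_B asymmetric_dyck_in_D0 r)
  fix d assume d: "d \<in> T r - {r}"
  with r show "d \<in> D0" using T_subset_D0 by blast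
  obtain e where "e \<in> T r" "d = B e" using d T_not_rootE by blast
  with r show "symmetric_dyck d" using T_subset_D0 symmetric_dyck_B_D0 by blast
qed

end
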